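(* Let $X$ be a Hausdorff space and let $G$ be a discrete group acting properly discontinuously on $X$ (on the right). Then $$\mathsf{TC}_{\mathsf{effv}}^{G}(X)\;\leq\;\mathsf{TC}_{\mathsf{effl}}^{G}(X)\;\leq\;\mathsf{TC}(X/G).$$
   Context: Sectional category is used in the reduced sense: for a map $f\colon E\to B$, $\mathsf{secat}(f)$ is one less than the minimal number of open sets covering $B$ on each of which $f$ admits a homotopy local section (i.e. a map $s\colon U\to E$ with $f\circ s$ homotopic to the inclusion $U\hookrightarrow B$); it is $\infty$ if no finite such cover exists. $PX$ denotes the space of free paths $[0,1]\to X$ (compact-open topology). Farber's topological complexity $\mathsf{TC}(Y)$ is $\mathsf{secat}$ of the end-points evaluation map $e_{01}\colon PY\to Y\times Y$, $e_{01}(\gamma)=(\gamma(0),\gamma(1))$. For a right $G$-space $X$: - Effective topological complexity: let $P_2^G(X)\subset PX\times G\times PX$ be the subspace of triples $(\alpha_1,g_1,\alpha_2)$ with $\alpha_1(1)\cdot g_1=\alpha_2(0)$. Then $\mathsf{TC}_{\mathsf{effv}}^G(X)$ is $\mathsf{secat}$ of the map $e_2\colon P_2^G(X)\to X\times X$, $e_2(\alpha_1,g_1,\alpha_2)=(\alpha_1(0),\alpha_2(1))$. - Effectual topological complexity: $\mathsf{TC}_{\mathsf{effl}}^G(X)$ is $\mathsf{secat}$ of the map $\epsilon\colon PX\to X\times (X/G)$, $\epsilon(\gamma)=(\gamma(0),[\gamma(1)])$, where $[\,\cdot\,]$ denotes $G$-orbits. The action is properly discontinuous if every $x\in X$ has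 a neighborhood $W$ such that $(W\cdot g)\cap W=\varnothing$ for all $g\in G$, $g\neq e$. In particular the action is free and $\pi\colon X\to X/G$ is a covering projection. *)

theory Defs
  imports "HOL-Analysis.Analysis" "HOL-Algebra.Group_Action"
begin

definition homotopy_local_section ::
  "'e topology \<Rightarrow> 'b topology \<Rightarrow> ('e \<Rightarrow> 'b) \<Rightarrow> 'b set \<Rightarrow> ('b \<Rightarrow> 'e) \<Rightarrow> bool" where
  "homotopy_local_section E B f U s \<longleftrightarrow>
     continuous_map (subtopology B U) E s \<and>
     homotopic_with (\<lambda>_. True) (subtopology B U) B (f \<circ> s) id"

text \<open>The value is an extended real because of the reduced normalisation: over an empty base the
  empty family is a cover, and the value is \<open>-1\<close>. The infimum of the empty set is \<open>\<infinity>\<close>; otherwise the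
  infimum is attained, the values being integers that are at least \<open>-1\<close>.\<close>

definition secat :: "'e topology \<Rightarrow> 'b topology \<Rightarrow> ('e \<Rightarrow> 'b) \<Rightarrow> ereal" where
  "secat E B f =
     (INF \<U> \<in> {\<U>. finite \<U> \<and> \<Union>\<U> = topspace B \<and>
                  (\<forall>U\<in>\<U>. openin B U \<and> (\<exists>s. homotopy_local_section E B f U s))}.
        ereal (real (card \<U>)) - 1)"

text \<open>A continuous map is represented by a function that is \<open>undefined\<close> outside the domain, so that
  maps agreeing on the domain are equal.\<close>

definition compact_open_topology :: "'a topology \<Rightarrow> 'b topology \<Rightarrow> ('a \<Rightarrow> 'b) topology" where
  "compact_open_topology X Y =
     topology_generated_by
       {{f \<in> extensional (topspace X). continuous_map X Y f \<and> f ` K \<subseteq> V} | K V.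
          compactin X K \<and> openin Y V}"

lemma topspace_compact_open_topology:
  "topspace (compact_open_topology X Y) = {f \<in> extensional (topspace X). continuous_map X Y f}"
proof -
  have "compactin X {}" "openin Y (topspace Y)"
    by auto
  then show ?thesis
    unfolding compact_open_topology_def topology_generated_by_topspace by blast
qed

definition path_space :: "'a topology \<Rightarrow> (real \<Rightarrow> 'a) topology" where
  "path_space X = compact_open_topology (top_of_set {0..1}) X"

definition TC :: "'a topology \<Rightarrow> ereal" where
  "TC Y = secat (path_space Y) (prod_topology Y Y) (\<lambda>\<gamma>. (\<gamma> 0, \<gamma> 1))"

locale topological_group = group G for G (structure) +
  fixes T :: "'a topology"
  assumes topspace_group: "topspace T = carrier G"
    and continuous_mult: "continuous_map (prod_topology T T) T (\<lambda>(g, h). g \<otimes> h)"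
    and continuous_inv: "continuous_map T T (\<lambda>g. inv g)"

locale right_G_space = topological_group G T for G (structure) and T +
  fixes X :: "'x topology" and act :: "'x \<Rightarrow> 'a \<Rightarrow> 'x"
  assumes continuous_act: "continuous_map (prod_topology X T) X (\<lambda>(x, g). act x g)"
    and act_one: "x \<in> topspace X \<Longrightarrow> act x \<one> = x"
    and act_mult: "\<lbrakk>x \<in> topspace X; g \<in> carrier G; h \<in> carrier G\<rbrakk>
                    \<Longrightarrow> act x (g \<otimes> h) = act (act x g) h"

definition properly_discontinuous ::
  "('g, 'b) monoid_scheme \<Rightarrow> 'x topology \<Rightarrow> ('x \<Rightarrow> 'g \<Rightarrow> 'x) \<Rightarrow> bool" where
  "properly_discontinuous G X act \<longleftrightarrow>
     (\<forall>x \<in> topspace X. \<exists>W. openin X W \<and> x \<in> W \<and>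
        (\<forall>g \<in> carrier G. g \<noteq> \<one>\<^bsub>G\<^esub> \<longrightarrow> (\<lambda>w. act w g) ` W \<inter> W = {}))"

definition quotient_topology :: "'a topology \<Rightarrow> ('a \<Rightarrow> 'b) \<Rightarrow> 'b topology" where
  "quotient_topology X q =
     topology (\<lambda>V. V \<subseteq> q ` topspace X \<and> openin X {x \<in> topspace X. q x \<in> V})"

lemma openin_quotient_topology:
  "openin (quotient_topology X q) V \<longleftrightarrow>
     V \<subseteq> q ` topspace X \<and> openin X {x \<in> topspace X. q x \<in> V}"
proof -
  have "istopology (\<lambda>V. V \<subseteq> q ` topspace X \<and> openin X {x \<in> topspace X. q x \<in> V})"
    unfolding istopology_def
  proof (intro conjI allI impI)
    fix S V
    assume "S \<subseteq> q ` topspace X \<and> openin X {x \<in> topspace X. q x \<in> S}"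
      and "V \<subseteq> q ` topspace X \<and> openin X {x \<in> topspace X. q x \<in> V}"
    moreover have "{x \<in> topspace X. q x \<in> S \<inter> V} =
        {x \<in> topspace X. q x \<in> S} \<inter> {x \<in> topspace X. q x \<in> V}"
      by auto
    ultimately show "S \<inter> V \<subseteq> q ` topspace X" "openin X {x \<in> topspace X. q x \<in> S \<inter> V}"
      by auto
  next
    fix \<K>
    assume *: "\<forall>K\<in>\<K>. K \<subseteq> q ` topspace X \<and> openin X {x \<in> topspace X. q x \<in> K}"
    have "{x \<in> topspace X. q x \<in> \<Union>\<K>} = (\<Union>K\<in>\<K>. {x \<in> topspace X. q x \<in> K})"
      by auto
    with * show "\<Union>\<K> \<subseteq> q ` topspace X" "openin X {x \<in> topspace X. q x \<in> \<Union>\<K>}"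
      by auto
  qed
  then show ?thesis
    by (simp add: quotient_topology_def)
qed

lemma topspace_quotient_topology: "topspace (quotient_topology X q) = q ` topspace X"
proof
  show "topspace (quotient_topology X q) \<subseteq> q ` topspace X"
    by (metis openin_quotient_topology openin_topspace)
  have "{x \<in> topspace X. q x \<in> q ` topspace X} = topspace X"
    by auto
  then have "openin (quotient_topology X q) (q ` topspace X)"
    by (simp add: openin_quotient_topology)
  then show "q ` topspace X \<subseteq> topspace (quotient_topology X q)"
    by (rule openin_subset)
qed

lemma quotient_map_quotient_topology: "quotient_map X (quotient_topology X q) q"
  by (simp add: quotient_map_def openin_quotient_topology topspace_quotient_topology)

definition orbit_map ::
  "('g, 'b) monoid_scheme \<Rightarrow> ('x \<Rightarrow> 'g \<Rightarrow> 'x) \<Rightarrow> 'x \<Rightarrow> 'x set" where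
  "orbit_map G act x = orbit G (\<lambda>g y. act y g) x"

definition orbit_space ::
  "('g, 'b) monoid_scheme \<Rightarrow> 'x topology \<Rightarrow> ('x \<Rightarrow> 'g \<Rightarrow> 'x) \<Rightarrow> 'x set topology" where
  "orbit_space G X act = quotient_topology X (orbit_map G act)"

definition broken_path_space ::
  "'g topology \<Rightarrow> 'x topology \<Rightarrow> ('x \<Rightarrow> 'g \<Rightarrow> 'x)
     \<Rightarrow> ((real \<Rightarrow> 'x) \<times> 'g \<times> (real \<Rightarrow> 'x)) topology" where
  "broken_path_space T X act =
     subtopology (prod_topology (path_space X) (prod_topology T (path_space X)))
       {(\<alpha>\<^sub>1, g\<^sub>1, \<alpha>\<^sub>2). act (\<alpha>\<^sub>1 1) g\<^sub>1 = \<alpha>\<^sub>2 0}"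

definition TC_effv :: "'g topology \<Rightarrow> 'x topology \<Rightarrow> ('x \<Rightarrow> 'g \<Rightarrow> 'x) \<Rightarrow> ereal" where
  "TC_effv T X act =
     secat (broken_path_space T X act) (prod_topology X X) (\<lambda>(\<alpha>\<^sub>1, g\<^sub>1, \<alpha>\<^sub>2). (\<alpha>\<^sub>1 0, \<alpha>\<^sub>2 1))"

definition TC_effl ::
  "('g, 'b) monoid_scheme \<Rightarrow> 'x topology \<Rightarrow> ('x \<Rightarrow> 'g \<Rightarrow> 'x) \<Rightarrow> ereal" where
  "TC_effl G X act =
     secat (path_space X) (prod_topology X (orbit_space G X act))
       (\<lambda>\<gamma>. (\<gamma> 0, orbit_map G act (\<gamma> 1)))"

end

theory Submission
  imports Defs
begin

text \<open>Both inequalities pull open sets back, along \<open>(x, y) \<mapsto> (x, [y])\<close> and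
  \<open>(x, b) \<mapsto> ([x], b)\<close> respectively, and rebuild the local sections by lifting homotopies through
  the covering \<open>X \<rightarrow> X/G\<close>. For the first, the homotopy from \<open>[\<gamma>(1)]\<close> to \<open>[y]\<close> is lifted with end
  \<open>y\<close>; its start lies in the orbit of \<open>\<gamma>(1)\<close>, the group element relating the two depends
  continuously on \<open>(x, y)\<close>, and the second path of the broken path can be taken constant. For the
  second, the homotopy from \<open>\<gamma>(0)\<close> to \<open>[x]\<close> is lifted with end \<open>x\<close>, and then \<open>\<gamma>\<close> itself is
  lifted from the start of that lift.\<close>

section \<open>Pulling back covers and local sections\<close>

text \<open>The preimages under \<open>h\<close> of the members of a cover of \<open>B\<close> form
  a cover of \<open>B'\<close>, and passing to preimages can only identify members, so the
  cardinality does not grow. A comparison of sectional categories thus reduces to the transport of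
  one local section at a time.\<close>

lemma secat_pullback_le:
  assumes h: "continuous_map B' B h"
    and section_pullback: "\<And>U s. openin B U \<Longrightarrow> homotopy_local_section E B f U s \<Longrightarrow>
      \<exists>s'. homotopy_local_section E' B' f' {x \<in> topspace B'. h x \<in> U} s'"
  shows "secat E' B' f' \<le> secat E B f"
  unfolding secat_def
proof (rule INF_greatest)
  fix \<U>
  assume "\<U> \<in> {\<U>. finite \<U> \<and> \<Union>\<U> = topspace B \<and>
    (\<forall>U\<in>\<U>. openin B U \<and> (\<exists>s. homotopy_local_section E B f U s))}"
  then have fin: "finite \<U>" and cov: "\<Union>\<U> = topspace B"
    and loc: "\<And>U. U \<in> \<U> \<Longrightarrow> openin B U \<and> (\<exists>s. homotopy_local_section E B f U s)"
    by auto
  let ?p = "\<lambda>U. {x \<in> topspace B'. h x \<in> U}"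
  have "h x \<in> \<Union>\<U>" if "x \<in> topspace B'" for x
    using that continuous_map_image_subset_topspace[OF h] unfolding cov by blast
  then have "\<Union>(?p ` \<U>) = topspace B'"
    by blast
  moreover have "openin B' (?p U) \<and> (\<exists>s. homotopy_local_section E' B' f' (?p U) s)"
    if "U \<in> \<U>" for U
    using loc[OF that] section_pullback openin_continuous_map_preimage[OF h] by blast
  moreover have "ereal (real (card (?p ` \<U>))) - 1 \<le> ereal (real (card \<U>)) - 1"
    using card_image_le[OF fin, of ?p] by (intro ereal_minus_mono) auto
  ultimately show "(INF \<U> \<in> {\<U>. finite \<U> \<and> \<Union>\<U> = topspace B' \<and>
      (\<forall>U\<in>\<U>. openin B' U \<and> (\<exists>s. homotopy_local_section E' B' f' U s))}.
      ereal (real (card \<U>)) - 1) \<le> ereal (real (card \<U>)) - 1"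
    using fin by (intro INF_lower2[of "?p ` \<U>"]) simp_all
qed

text \<open>The definition of \<open>homotopic_with\<close> prescribes the ends of the homotopy at
  all points of the type. Here they are prescribed only over \<open>U\<close>, which is where a
  lifted homotopy is under control.\<close>

lemma homotopy_local_sectionI:
  assumes "continuous_map (subtopology B U) E s"
    and "continuous_map (prod_topology (top_of_set {0..1::real}) (subtopology B U)) B H"
    and "\<And>z. z \<in> topspace (subtopology B U) \<Longrightarrow> H (0, z) = f (s z)"
    and "\<And>z. z \<in> topspace (subtopology B U) \<Longrightarrow> H (1, z) = z"
  shows "homotopy_local_section E B f U s"
  unfolding homotopy_local_section_def
proof (intro conjI)
  show "homotopic_with (\<lambda>_. True) (subtopology B U) B (f \<circ> s) id"
    using assms(2-4) by (subst homotopic_with) (auto intro!: exI[of _ H])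
qed (rule assms(1))

text \<open>Section and homotopy are precomposed with \<open>h\<close>. The resulting homotopy ends
  at \<open>h\<close> and not at the identity; one of its components is later lifted through the
  orbit map to repair this.\<close>

lemma homotopy_local_section_pullback:
  assumes h: "continuous_map B' B h" and s: "homotopy_local_section E B f U s"
    and Z: "Z = subtopology B' {x \<in> topspace B'. h x \<in> U}"
  obtains H where "continuous_map Z E (\<lambda>z. s (h z))"
    "continuous_map (prod_topology (top_of_set {0..1::real}) Z) B H"
    "\<And>z. z \<in> topspace Z \<Longrightarrow> H (0, z) = f (s (h z))"
    "\<And>z. z \<in> topspace Z \<Longrightarrow> H (1, z) = h z"
proof -
  let ?I = "top_of_set {0..1::real}"
  have hZ: "continuous_map Z (subtopology B U) h"
    unfolding Z using h by (auto simp: continuous_map_in_subtopology continuous_map_from_subtopology)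
  obtain H where H: "continuous_map (prod_topology ?I (subtopology B U)) B H"
      "\<And>x. H (0, x) = f (s x)" "\<And>x. H (1, x) = x"
    and sU: "continuous_map (subtopology B U) E s"
    using s unfolding homotopy_local_section_def homotopic_with_def by auto
  have "continuous_map (prod_topology ?I Z) (prod_topology ?I (subtopology B U))
      (\<lambda>y. (fst y, h (snd y)))"
    by (intro continuous_map_pairedI continuous_map_fst
        continuous_map_compose[OF continuous_map_snd hZ, unfolded o_def])
  from continuous_map_compose[OF this H(1)]
  have "continuous_map (prod_topology ?I Z) B (\<lambda>y. H (fst y, h (snd y)))"
    by (simp add: o_def)
  then show thesis
    using that[of "\<lambda>y. H (fst y, h (snd y))"] continuous_map_compose[OF hZ sU] H(2,3)
    by (simp add: o_def)
qed

section \<open>Evaluation and currying for the compact-open topology\<close>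

text \<open>Compact neighbourhoods form a base, so \<open>x\<close> has one, \<open>K\<close>, that
  \<open>f\<close> maps into \<open>V\<close>. The maps sending \<open>K\<close> into
  \<open>V\<close> form a subbasic open set, and evaluation sends its product with the interior part
  \<open>O'\<close> of \<open>K\<close> into \<open>V\<close>.\<close>

lemma continuous_map_compact_open_eval:
  assumes "locally_compact_space X" "Hausdorff_space X \<or> regular_space X"
  shows "continuous_map (prod_topology X (compact_open_topology X Y)) Y (\<lambda>(x, f). f x)"
  unfolding continuous_map_def
proof (intro conjI allI impI)
  show "(\<lambda>(x, f). f x) \<in> topspace (prod_topology X (compact_open_topology X Y)) \<rightarrow> topspace Y"
    by (auto simp: topspace_compact_open_topology continuous_map_def)
next
  fix V assume V: "openin Y V"
  let ?P = "{z \<in> topspace (prod_topology X (compact_open_topology X Y)).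
              (case z of (x, f) \<Rightarrow> f x) \<in> V}"
  show "openin (prod_topology X (compact_open_topology X Y)) ?P"
    unfolding openin_prod_topology_alt
  proof (intro allI impI)
    fix x f assume "(x, f) \<in> ?P"
    then have x: "x \<in> topspace X" and f: "f \<in> extensional (topspace X)" "continuous_map X Y f"
      and fx: "f x \<in> V"
      by (auto simp: topspace_compact_open_topology)
    have "neighbourhood_base_of (compactin X) X"
      using assms locally_compact_space_neighbourhood_base by blast
    moreover have "openin X {x \<in> topspace X. f x \<in> V}"
      using f(2) V by (rule openin_continuous_map_preimage)
    ultimately have "\<exists>O' K. openin X O' \<and> compactin X K \<and> x \<in> O' \<and> O' \<subseteq> K \<and>
        K \<subseteq> {x \<in> topspace X. f x \<in> V}"
      unfolding neighbourhood_base_of using x fx by simp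
    then obtain O' K where O': "openin X O'" "compactin X K" "x \<in> O'" "O' \<subseteq> K"
        "K \<subseteq> {x \<in> topspace X. f x \<in> V}"
      by blast
    let ?S = "{f \<in> extensional (topspace X). continuous_map X Y f \<and> f ` K \<subseteq> V}"
    have "openin (compact_open_topology X Y) ?S"
      unfolding compact_open_topology_def using O'(2) V
      by (intro topology_generated_by_Basis) blast
    moreover have "O' \<times> ?S \<subseteq> ?P"
      using openin_subset[OF O'(1)] O'(4) by (auto simp: topspace_compact_open_topology)
    moreover have "f \<in> ?S" using f O' by auto
    ultimately show "\<exists>U V. openin X U \<and> openin (compact_open_topology X Y) V \<and>
        x \<in> U \<and> f \<in> V \<and> U \<times> V \<subseteq> ?P"
      using O' by blast
  qed
qed

text \<open>It suffices to test subbasic open sets, and there the tube lemma applies: if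
  \<open>F\<close> maps \<open>K\<close> times a point \<open>z\<close> into \<open>V\<close> with
  \<open>K\<close> compact, then it maps \<open>K\<close> times a neighbourhood of \<open>z\<close>
  into \<open>V\<close>. The restriction to \<open>topspace X\<close> makes the values extensional,
  as the function space demands.\<close>

lemma continuous_map_compact_open_curry:
  assumes F: "continuous_map (prod_topology X Z) Y F"
  shows "continuous_map Z (compact_open_topology X Y) (\<lambda>z. \<lambda>x\<in>topspace X. F (x, z))"
proof -
  let ?c = "\<lambda>z. \<lambda>x\<in>topspace X. F (x, z)"
  have slice: "continuous_map X Y (?c z)" if "z \<in> topspace Z" for z
  proof -
    have "continuous_map X Y (F \<circ> (\<lambda>x. (x, z)))"
      using that by (intro continuous_map_compose[OF _ F]) (simp add: continuous_map_pairedI)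
    then show ?thesis
      by (rule continuous_map_eq) auto
  qed
  show ?thesis
    unfolding compact_open_topology_def
  proof (rule continuous_on_generated_topo)
    fix U
    assume "U \<in> {{f \<in> extensional (topspace X). continuous_map X Y f \<and> f ` K \<subseteq> V} | K V.
          compactin X K \<and> openin Y V}"
    then obtain K V where K: "compactin X K" and V: "openin Y V"
      and U: "U = {f \<in> extensional (topspace X). continuous_map X Y f \<and> f ` K \<subseteq> V}"
      by (elim CollectE exE conjE)
    have KX: "K \<subseteq> topspace X" using K compactin_subset_topspace by blast
    show "openin Z (?c -` U \<inter> topspace Z)"
    proof (subst openin_subopen, intro ballI)
      fix z assume z: "z \<in> ?c -` U \<inter> topspace Z"
      let ?W = "{w \<in> topspace (prod_topology X Z). F w \<in> V}"
      have "F (k, z) \<in> V" if "k \<in> K" for k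
        using z that KX unfolding U by (auto simp: image_subset_iff subset_iff)
      then have "K \<times> {z} \<subseteq> ?W"
        using z KX by auto
      then obtain A N where AN: "openin Z N" "K \<subseteq> A" "z \<in> N" "A \<times> N \<subseteq> ?W"
        using tube_lemma_left[OF openin_continuous_map_preimage[OF F V] K, of z] z
        by auto
      have "?c w \<in> U" if "w \<in> N" for w
      proof -
        have "w \<in> topspace Z" using that AN(1) openin_subset by blast
        moreover have "F (k, w) \<in> V" if "k \<in> K" for k
          using that \<open>w \<in> N\<close> AN by blast
        ultimately show ?thesis
          unfolding U using slice[of w] KX by auto
      qed
      then have "N \<subseteq> ?c -` U \<inter> topspace Z"
        using openin_subset[OF AN(1)] by blast
      then show "\<exists>T. openin Z T \<and> z \<in> T \<and> T \<subseteq> ?c -` U \<inter> topspace Z"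
        using AN by blast
    qed
  next
    have "?c ` topspace Z \<subseteq> topspace (compact_open_topology X Y)"
      using slice by (auto simp: topspace_compact_open_topology)
    then show "?c ` topspace Z \<subseteq> \<Union> {{f \<in> extensional (topspace X).
        continuous_map X Y f \<and> f ` K \<subseteq> V} | K V. compactin X K \<and> openin Y V}"
      by (simp add: compact_open_topology_def topology_generated_by_topspace)
  qed
qed

lemma continuous_map_path_space_curry:
  assumes "continuous_map (prod_topology (top_of_set {0..1}) Z) X F"
  shows "continuous_map Z (path_space X) (\<lambda>z. \<lambda>t\<in>{0..1}. F (t, z))"
  using continuous_map_compact_open_curry[OF assms] by (simp add: path_space_def)

lemma continuous_map_path_space_uncurry:
  assumes s: "continuous_map Z (path_space X) s"
  shows "continuous_map (prod_topology (top_of_set {0..1}) Z) X (\<lambda>(t, z). s z t)"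
proof -
  let ?I = "top_of_set {0..1::real}"
  have "locally_compact_space ?I" "Hausdorff_space ?I"
    by (auto intro!: compact_imp_locally_compact_space simp: compact_space_subtopology
        Hausdorff_space_subtopology)
  then have "continuous_map (prod_topology ?I (path_space X)) X (\<lambda>(t, \<gamma>). \<gamma> t)"
    unfolding path_space_def by (intro continuous_map_compact_open_eval) auto
  moreover have "continuous_map (prod_topology ?I Z) (prod_topology ?I (path_space X))
      (\<lambda>(t, z). (t, s z))"
    unfolding case_prod_unfold
    by (intro continuous_map_pairedI continuous_map_fst
        continuous_map_compose[OF continuous_map_snd s, unfolded o_def])
  ultimately have "continuous_map (prod_topology ?I Z) X ((\<lambda>(t, \<gamma>). \<gamma> t) \<circ> (\<lambda>(t, z). (t, s z)))"
    by (rule continuous_map_compose[rotated])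
  then show ?thesis
    by (simp add: o_def case_prod_unfold)
qed

lemma continuous_map_path_space_eval:
  assumes s: "continuous_map Z (path_space X) s" and t: "t \<in> {0..1}"
  shows "continuous_map Z X (\<lambda>z. s z t)"
proof -
  have "continuous_map Z (prod_topology (top_of_set {0..1}) Z) (\<lambda>z. (t, z))"
    using t by (intro continuous_map_pairedI) auto
  from continuous_map_compose[OF this continuous_map_path_space_uncurry[OF s]]
  show ?thesis by (simp add: o_def)
qed

section \<open>The action and its orbit map\<close>

locale properly_discontinuous_space =
  right_G_space G "discrete_topology (carrier G)" X act for G (structure) and X :: "'x topology" and act +
  assumes properly_discontinuous: "properly_discontinuous G X act"
begin

abbreviation p where "p \<equiv> orbit_map G act"

abbreviation Q where "Q \<equiv> orbit_space G X act"

lemma continuous_map_act: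
  assumes "g \<in> carrier G"
  shows "continuous_map X X (\<lambda>x. act x g)"
proof -
  have "continuous_map X (prod_topology X (discrete_topology (carrier G))) (\<lambda>x. (x, g))"
    using assms by (intro continuous_map_pairedI) auto
  from continuous_map_compose[OF this continuous_act] show ?thesis
    by (simp add: o_def)
qed

lemma act_closed: "\<lbrakk>x \<in> topspace X; g \<in> carrier G\<rbrakk> \<Longrightarrow> act x g \<in> topspace X"
  using continuous_map_act continuous_map_image_subset_topspace by fastforce

lemma act_inv: "\<lbrakk>x \<in> topspace X; g \<in> carrier G\<rbrakk> \<Longrightarrow> act (act x g) (inv g) = x"
  by (metis act_mult act_one inv_closed r_inv)

lemma act_inv': "\<lbrakk>x \<in> topspace X; g \<in> carrier G\<rbrakk> \<Longrightarrow> act (act x (inv g)) g = x"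
  by (metis act_inv inv_closed inv_inv)

lemma orbit_map_eq: "p x = {act x g | g. g \<in> carrier G}"
  by (simp add: orbit_map_def orbit_def)

lemma orbit_map_act:
  assumes "x \<in> topspace X" "g \<in> carrier G"
  shows "p (act x g) = p x"
proof -
  have "\<exists>k\<in>carrier G. act x h = act (act x g) k" if "h \<in> carrier G" for h
    using assms that
    by (intro bexI[of _ "inv g \<otimes> h"]) (simp_all add: act_mult act_closed act_inv)
  moreover have "\<exists>k\<in>carrier G. act (act x g) h = act x k" if "h \<in> carrier G" for h
    using assms that by (intro bexI[of _ "g \<otimes> h"]) (simp_all add: act_mult)
  ultimately show ?thesis
    unfolding orbit_map_eq by blast
qed

lemma orbit_map_eq_iff:
  assumes "x \<in> topspace X" "y \<in> topspace X"
  shows "p x = p y \<longleftrightarrow> (\<exists>g \<in> carrier G. act x g = y)"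
proof
  assume "p x = p y"
  moreover have "y \<in> p y"
    unfolding orbit_map_eq using assms act_one by force
  ultimately have "y \<in> p x" by simp
  then show "\<exists>g \<in> carrier G. act x g = y"
    by (auto simp: orbit_map_eq)
next
  show "\<exists>g\<in>carrier G. act x g = y \<Longrightarrow> p x = p y"
    using orbit_map_act assms by auto
qed

lemma topspace_orbit_space: "topspace Q = p ` topspace X"
  by (simp add: orbit_space_def topspace_quotient_topology)

lemma continuous_map_orbit_map: "continuous_map X Q p"
  unfolding orbit_space_def
  by (intro quotient_imp_continuous_map quotient_map_quotient_topology)

lemma openin_act_image:
  assumes "openin X W" "g \<in> carrier G"
  shows "openin X ((\<lambda>x. act x g) ` W)"
proof -
  have WX: "W \<subseteq> topspace X" using assms openin_subset by blast
  have "(\<lambda>x. act x g) ` W = {y \<in> topspace X. act y (inv g) \<in> W}"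
  proof (intro equalityI subsetI)
    fix y assume "y \<in> {y \<in> topspace X. act y (inv g) \<in> W}"
    then show "y \<in> (\<lambda>x. act x g) ` W"
      using assms act_inv' by (metis (no_types, lifting) imageI mem_Collect_eq)
  qed (use assms WX act_closed act_inv in auto)
  then show ?thesis
    using openin_continuous_map_preimage[OF continuous_map_act] assms by simp
qed

text \<open>The saturation of \<open>W\<close> is the union of its translates, and these are open
  because each group element acts by a homeomorphism.\<close>

lemma openin_orbit_map_image:
  assumes "openin X W"
  shows "openin Q (p ` W)"
proof -
  have WX: "W \<subseteq> topspace X" using assms openin_subset by blast
  have "{x \<in> topspace X. p x \<in> p ` W} = (\<Union>g\<in>carrier G. (\<lambda>x. act x g) ` W)"
  proof (intro equalityI subsetI)
    fix x assume "x \<in> {x \<in> topspace X. p x \<in> p ` W}"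
    then obtain w where "x \<in> topspace X" "w \<in> W" "p w = p x" by auto
    then show "x \<in> (\<Union>g\<in>carrier G. (\<lambda>x. act x g) ` W)"
      using orbit_map_eq_iff[of w x] WX by blast
  qed (use WX act_closed orbit_map_act in blast)
  then show ?thesis
    unfolding orbit_space_def openin_quotient_topology
    using openin_act_image[OF assms] WX by auto
qed

text \<open>This is proper discontinuity read contrapositively. Such a slice \<open>W\<close> is the
  source of freeness, of the local constancy of \<open>translation\<close> and of local sections of
  the orbit map.\<close>

lemma slice_exists:
  assumes "x \<in> topspace X"
  obtains W where "openin X W" "x \<in> W"
    "\<And>w g. \<lbrakk>w \<in> W; g \<in> carrier G; act w g \<in> W\<rbrakk> \<Longrightarrow> g = \<one>"
proof -
  obtain W where W: "openin X W" "x \<in> W"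
    "\<forall>g\<in>carrier G. g \<noteq> \<one> \<longrightarrow> (\<lambda>w. act w g) ` W \<inter> W = {}"
    using bspec[OF properly_discontinuous[unfolded properly_discontinuous_def] assms]
    by (elim exE conjE)
  show thesis
  proof (rule that[OF W(1,2)])
    show "g = \<one>" if "w \<in> W" "g \<in> carrier G" "act w g \<in> W" for w g
      using W(3) that by (metis IntI empty_iff imageI)
  qed
qed

section \<open>Freeness and the translation function\<close>

text \<open>The element \<open>g \<otimes> inv h\<close> fixes \<open>x\<close>, hence carries a
  point of a slice back into that slice, which forces it to be \<open>\<one>\<close>.\<close>

lemma act_free:
  assumes x: "x \<in> topspace X" and G: "g \<in> carrier G" "h \<in> carrier G" and eq: "act x g = act x h"
  shows "g = h"
proof -
  obtain W where W: "openin X W" "x \<in> W"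
    "\<And>w g. \<lbrakk>w \<in> W; g \<in> carrier G; act w g \<in> W\<rbrakk> \<Longrightarrow> g = \<one>"
    by (rule slice_exists[OF x]) blast
  have "act x (g \<otimes> inv h) = x"
    using act_mult[OF x G(1) inv_closed[OF G(2)]] act_inv[OF x G(2)] eq by simp
  then have "g \<otimes> inv h = \<one>"
    using W(2) G by (intro W(3)[of x]) simp_all
  then show ?thesis
    using inv_equality[of g "inv h"] G by simp
qed

text \<open>The translation function of a principal bundle. Freeness makes the description unique
  for two points of one orbit; on other pairs the value is unspecified.\<close>

definition translation :: "'x \<times> 'x \<Rightarrow> 'a" where
  "translation = (\<lambda>(x, y). THE g. g \<in> carrier G \<and> act x g = y)"

lemma translation_eqI:
  assumes "x \<in> topspace X" "g \<in> carrier G" "act x g = y"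
  shows "translation (x, y) = g"
  unfolding translation_def prod.case
proof (rule the_equality)
  show "h = g" if "h \<in> carrier G \<and> act x h = y" for h
    using act_free[OF assms(1), of h g] assms that by simp
qed (use assms in simp)

lemma translation:
  assumes "x \<in> topspace X" "y \<in> topspace X" "p x = p y"
  shows "translation (x, y) \<in> carrier G" "act x (translation (x, y)) = y"
proof -
  obtain g where "g \<in> carrier G" "act x g = y"
    using assms orbit_map_eq_iff by auto
  then show "translation (x, y) \<in> carrier G" "act x (translation (x, y)) = y"
    using assms(1) translation_eqI by auto
qed

text \<open>Continuity into a discrete group is local constancy. Near a pair
  \<open>(x, act x g)\<close> take \<open>u\<close> in a slice \<open>W\<close> around
  \<open>x\<close> and \<open>v = act w g\<close> with \<open>w\<close> in \<open>W\<close>. If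
  \<open>u\<close> and \<open>v\<close> share an orbit, then so do \<open>u\<close> and
  \<open>w\<close>, the slice property gives \<open>w = u\<close>, and the translation is again
  \<open>g\<close>.\<close>

lemma continuous_map_translation:
  "continuous_map (subtopology (prod_topology X X) {(x, y). p x = p y})
     (discrete_topology (carrier G)) translation"
  unfolding continuous_map_def
proof (intro conjI allI impI)
  let ?R = "subtopology (prod_topology X X) {(x, y). p x = p y}"
  show "translation \<in> topspace ?R \<rightarrow> topspace (discrete_topology (carrier G))"
    using translation by auto
  fix S assume "openin (discrete_topology (carrier G)) S"
  show "openin ?R {z \<in> topspace ?R. translation z \<in> S}"
  proof (subst openin_subopen, intro ballI)
    fix z assume z: "z \<in> {z \<in> topspace ?R. translation z \<in> S}"
    obtain x y where [simp]: "z = (x, y)" by fastforce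
    define g where "g = translation (x, y)"
    have xy: "x \<in> topspace X" "y \<in> topspace X" "p x = p y" and gS: "g \<in> S"
      using z by (auto simp: g_def)
    then have g: "g \<in> carrier G" "act x g = y"
      using translation by (auto simp: g_def)
    obtain W where W: "openin X W" "x \<in> W"
      "\<And>w g. \<lbrakk>w \<in> W; g \<in> carrier G; act w g \<in> W\<rbrakk> \<Longrightarrow> g = \<one>"
      by (rule slice_exists[OF xy(1)]) blast
    have WX: "W \<subseteq> topspace X" using W openin_subset by blast
    let ?Wg = "(\<lambda>x. act x g) ` W"
    let ?N = "{(x, y). p x = p y} \<inter> W \<times> ?Wg"
    have "openin ?R ?N"
      using W g openin_act_image
      by (intro openin_subtopology_Int2) (simp add: openin_prod_Times_iff)
    moreover have "translation (u, v) = g" if uv: "(u, v) \<in> ?N" for u v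
    proof -
      obtain w where uw: "u \<in> W" "w \<in> W" "v = act w g" "p u = p v"
        using uv by blast
      then have "p u = p w" using WX g orbit_map_act by auto
      then obtain h where h: "h \<in> carrier G" "act u h = w"
        using orbit_map_eq_iff uw WX by blast
      then have "w = u" using W(3)[of u h] uw WX act_one by auto
      then show ?thesis using uw g WX by (auto intro!: translation_eqI)
    qed
    then have "?N \<subseteq> {z \<in> topspace ?R. translation z \<in> S}"
      using gS WX g act_closed by (auto simp: subset_iff)
    moreover have "z \<in> ?N"
      using xy g W by auto
    ultimately show "\<exists>T. openin ?R T \<and> z \<in> T \<and> T \<subseteq> {z \<in> topspace ?R. translation z \<in> S}"
      by blast
  qed
qed

lemma continuous_map_translation_compose:
  assumes "continuous_map Z X u" "continuous_map Z X v"
    "\<And>z. z \<in> topspace Z \<Longrightarrow> p (u z) = p (v z)"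
  shows "continuous_map Z (discrete_topology (carrier G)) (\<lambda>z. translation (u z, v z))"
proof -
  have "continuous_map Z (subtopology (prod_topology X X) {(x, y). p x = p y}) (\<lambda>z. (u z, v z))"
    using assms by (auto simp: continuous_map_in_subtopology intro!: continuous_map_pairedI)
  from continuous_map_compose[OF this continuous_map_translation] show ?thesis
    by (simp add: o_def)
qed

section \<open>Lifting through the orbit map\<close>

text \<open>The translation from \<open>u\<close> to \<open>v\<close> is a continuous map from a
  connected space to a discrete one, so it is constant; at \<open>c\<close> its value is
  \<open>\<one>\<close>.\<close>

lemma lift_unique:
  assumes "connected_space C" "continuous_map C X u" "continuous_map C X v"
    and puv: "\<And>c. c \<in> topspace C \<Longrightarrow> p (u c) = p (v c)"
    and c: "c \<in> topspace C" "u c = v c" and d: "d \<in> topspace C"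
  shows "u d = v d"
proof -
  let ?h = "\<lambda>c. translation (u c, v c)"
  have X: "u c \<in> topspace X" "v c \<in> topspace X" if "c \<in> topspace C" for c
    using that continuous_map_image_subset_topspace[OF assms(2)]
      continuous_map_image_subset_topspace[OF assms(3)] by blast+
  have "connectedin (discrete_topology (carrier G)) (?h ` topspace C)"
    using connectedin_continuous_map_image[OF continuous_map_translation_compose[OF assms(2-4)]]
      assms(1) by (simp add: connectedin_topspace)
  then obtain a where "?h ` topspace C \<subseteq> {a}"
    unfolding connectedin_discrete_topology by (elim conjE exE)
  then have "?h d = ?h c"
    unfolding image_subset_iff using bspec c(1) d by (metis (no_types, lifting) singletonD)
  moreover have "?h c = \<one>"
    using translation_eqI[of "u c" \<one> "v c"] X(1)[OF c(1)] c(2) act_one by simp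
  ultimately have "?h d = \<one>" by simp
  then show ?thesis
    using translation(2)[OF X[OF d] puv[OF d]] act_one[OF X(1)[OF d]] by simp
qed

text \<open>The orbit map is injective on a slice \<open>W\<close>. Its inverse \<sigma> there is
  continuous because the preimage of an open \<open>V\<close> is the image of
  \<open>W \<inter> V\<close>, and the orbit map is open.\<close>

lemma local_section:
  assumes "x \<in> topspace X"
  obtains W \<sigma> where "openin X W" "x \<in> W" "continuous_map (subtopology Q (p ` W)) X \<sigma>"
    "\<And>w. w \<in> W \<Longrightarrow> \<sigma> (p w) = w"
proof -
  obtain W where W: "openin X W" "x \<in> W"
    "\<And>w g. \<lbrakk>w \<in> W; g \<in> carrier G; act w g \<in> W\<rbrakk> \<Longrightarrow> g = \<one>"
    by (rule slice_exists[OF assms]) blast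
  have WX: "W \<subseteq> topspace X" using W openin_subset by blast
  have inj: "inj_on p W"
  proof (rule inj_onI)
    fix a b assume ab: "a \<in> W" "b \<in> W" "p a = p b"
    then obtain g where "g \<in> carrier G" "act a g = b"
      using orbit_map_eq_iff WX by blast
    then show "a = b" using W(3)[of a g] ab WX act_one by auto
  qed
  let ?\<sigma> = "inv_into W p"
  have "continuous_map (subtopology Q (p ` W)) X ?\<sigma>"
    unfolding continuous_map_def
  proof (intro conjI allI impI)
    show "?\<sigma> \<in> topspace (subtopology Q (p ` W)) \<rightarrow> topspace X"
      using WX inv_into_into[of _ p W] by auto
    fix V assume V: "openin X V"
    have "{q \<in> topspace (subtopology Q (p ` W)). ?\<sigma> q \<in> V} = p ` W \<inter> p ` (W \<inter> V)"
      using WX inj by (auto simp: topspace_orbit_space)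
    moreover have "openin (subtopology Q (p ` W)) (p ` W \<inter> p ` (W \<inter> V))"
      by (intro openin_subtopology_Int2 openin_orbit_map_image openin_Int W(1) V)
    ultimately show "openin (subtopology Q (p ` W)) {q \<in> topspace (subtopology Q (p ` W)). ?\<sigma> q \<in> V}"
      by simp
  qed
  moreover have "?\<sigma> (p w) = w" if "w \<in> W" for w
    using inj that by simp
  ultimately show thesis
    by (rule that[OF W(1,2)])
qed

text \<open>The homotopy lifting property near a single parameter \<open>z\<close>: along the
  compact interval finitely many local sections suffice, so one neighbourhood of \<open>z\<close>
  serves for all times.\<close>

lemma lift_extension:
  assumes F: "continuous_map (prod_topology (top_of_set {0..1::real}) Z) Q F" and z: "z \<in> topspace Z"
    and f: "continuous_map Z X f" "\<And>w. w \<in> topspace Z \<Longrightarrow> p (f w) = F (0, w)"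
  obtains M L where "openin Z M" "z \<in> M"
    "continuous_map (prod_topology (top_of_set {0..1}) (subtopology Z M)) X L"
    "\<And>w. w \<in> M \<Longrightarrow> L (0, w) = f w"
    "\<And>t w. \<lbrakk>t \<in> {0..1}; w \<in> M\<rbrakk> \<Longrightarrow> p (L (t, w)) = F (t, w)"
proof -
  let ?I = "top_of_set {0..1::real}"
  \<comment> \<open>The strip over \<open>{a..b}\<close> and \<open>M\<close> is cut out of the full
    product with the real line, so that strips with different bounds are compared by inclusion of
    sets alone.\<close>
  define S where "S a b M = subtopology (prod_topology euclideanreal Z) ({a..b} \<times> M)" for a b M
  have S_eq: "S a b M = prod_topology (top_of_set {a..b}) (subtopology Z M)" for a b M
    by (simp add: S_def subtopology_Times)
  \<comment> \<open>\<open>start\<close> describes initial data \<open>g\<close> at time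
    \<open>a\<close> over a neighbourhood \<open>N\<close> of \<open>z\<close>; \<open>ext\<close>
    describes a lift \<open>L\<close> up to time \<open>b\<close> that continues \<open>g\<close>
    over a smaller neighbourhood \<open>M\<close>.\<close>
  define start where "start a N g \<longleftrightarrow> openin Z N \<and> z \<in> N \<and> continuous_map (subtopology Z N) X g \<and>
    (\<forall>w\<in>N. p (g w) = F (a, w))" for a N g
  define ext where "ext a b N g M L \<longleftrightarrow> openin Z M \<and> z \<in> M \<and> M \<subseteq> N \<and> continuous_map (S a b M) X L \<and>
    (\<forall>w\<in>M. L (a, w) = g w) \<and> (\<forall>t\<in>{a..b}. \<forall>w\<in>M. p (L (t, w)) = F (t, w))" for a b N g M L
  have inner: "continuous_map (subtopology Z M) (S a b M) (\<lambda>w. (t, w))" if "t \<in> {a..b}" for a b t M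
    unfolding S_eq using that by (intro continuous_map_pairedI) auto
  have S_mono: "continuous_map (S a b M) Y h"
    if "continuous_map (S c d N) Y h" "{a..b} \<subseteq> {c..d}" "M \<subseteq> N" for a b c d M N Y h
    using that unfolding S_def by (elim continuous_map_from_subtopology_mono) auto
  have FS: "continuous_map (S a b M) Q F" if "0 \<le> a" "b \<le> 1" "openin Z M" for a b M
  proof (rule S_mono)
    show "continuous_map (S 0 1 (topspace Z)) Q F" using F by (simp add: S_eq)
  qed (use that openin_subset in auto)
  \<comment> \<open>Lifts exist over short intervals and concatenate; the neighbourhood of \<open>z\<close> may shrink at each
    of the finitely many steps.\<close>
  have "0 \<le> (0::real) \<longrightarrow> (1::real) \<le> 1 \<longrightarrow> (\<forall>N g. start 0 N g \<longrightarrow> (\<exists>M L. ext 0 1 N g M L))"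
  proof (rule Bolzano[where P = "\<lambda>a b. 0 \<le> a \<longrightarrow> b \<le> 1 \<longrightarrow>
        (\<forall>N g. start a N g \<longrightarrow> (\<exists>M L. ext a b N g M L))"], simp, goal_cases)
    case (1 a b c)
    show ?case
    proof (intro impI allI)
      fix N g assume "0 \<le> a" "c \<le> 1" "start a N g"
      with 1 obtain M1 L1 where L1: "ext a b N g M1 L1" by force
      with 1(4) have "start b M1 (\<lambda>w. L1 (b, w))"
        unfolding start_def ext_def
        using continuous_map_compose[OF inner[of b a b M1], of X L1] 1(3) by (auto simp: o_def)
      with 1 \<open>0 \<le> a\<close> \<open>c \<le> 1\<close> obtain M2 L2 where L2: "ext b c M1 (\<lambda>w. L1 (b, w)) M2 L2" by force
      \<comment> \<open>The two lifts agree at time \<open>b\<close>, since the initial data of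
        \<open>L2\<close> are the final values of \<open>L1\<close>.\<close>
      let ?L = "\<lambda>x. if fst x \<le> b then L1 x else L2 x"
      have M21: "M2 \<subseteq> M1" using L2 by (simp add: ext_def)
      have "continuous_map (S a c M2) X ?L"
      proof (rule continuous_map_cases_le)
        show "continuous_map (S a c M2) euclideanreal fst"
          unfolding S_def by (intro continuous_map_from_subtopology continuous_map_fst)
        have "continuous_map (S a b M2) X L1"
          using L1 M21 unfolding ext_def by (auto intro: S_mono)
        then show "continuous_map (subtopology (S a c M2) {x \<in> topspace (S a c M2). fst x \<le> b}) X L1"
          unfolding S_def subtopology_subtopology
          by (elim continuous_map_from_subtopology_mono) auto
        have "continuous_map (S b c M2) X L2"
          using L2 unfolding ext_def by auto
        then show "continuous_map (subtopology (S a c M2) {x \<in> topspace (S a c M2). b \<le> fst x}) X L2"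
          unfolding S_def subtopology_subtopology
          by (elim continuous_map_from_subtopology_mono) auto
        show "L1 x = L2 x" if "x \<in> topspace (S a c M2)" "fst x = b" for x
          using that L2 unfolding ext_def S_def by (cases x) auto
      qed simp
      then have "ext a c N g M2 ?L"
        using L1 L2 M21 1(3,4) unfolding ext_def by (auto simp: subset_iff)
      then show "\<exists>M L. ext a c N g M L" by blast
    qed
  next
    case (2 x)
    then have "F (x, z) \<in> topspace Q"
      using z continuous_map_image_subset_topspace[OF F] by auto
    \<comment> \<open>Around a point \<open>x0\<close> over \<open>F (x, z)\<close> there is an open
      set \<open>W\<close> on whose image \<sigma> inverts the orbit map; \<open>F\<close> stays in
      that image on a product neighbourhood \<open>A \<times> N0\<close> of
      \<open>(x, z)\<close>.\<close>
    then obtain x0 where x0: "x0 \<in> topspace X" "p x0 = F (x, z)"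
      by (auto simp: topspace_orbit_space)
    obtain W \<sigma> where W: "openin X W" "x0 \<in> W" and \<sigma>: "continuous_map (subtopology Q (p ` W)) X \<sigma>"
      "\<And>w. w \<in> W \<Longrightarrow> \<sigma> (p w) = w"
      using local_section x0 by metis
    have p\<sigma>: "p (\<sigma> q) = q" if "q \<in> p ` W" for q
      using that \<sigma> by auto
    have "openin (prod_topology ?I Z) {y \<in> topspace (prod_topology ?I Z). F y \<in> p ` W}"
      using openin_continuous_map_preimage[OF F openin_orbit_map_image[OF W(1)]] .
    moreover have "(x, z) \<in> {y \<in> topspace (prod_topology ?I Z). F y \<in> p ` W}"
      using 2 z W(2) by (auto simp flip: x0(2))
    ultimately obtain A N0 where A: "openin ?I A" "x \<in> A" and N0: "openin Z N0" "z \<in> N0"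
      and AN: "A \<times> N0 \<subseteq> {y \<in> topspace (prod_topology ?I Z). F y \<in> p ` W}"
      unfolding openin_prod_topology_alt by meson
    \<comment> \<open>A subinterval of \<open>{0..1}\<close> that contains \<open>x\<close> and is
      shorter than \<open>d\<close> lies in \<open>A\<close>, so a single local section serves for
      all its times.\<close>
    obtain d where d: "d > 0" "\<And>t. t \<in> {0..1} \<Longrightarrow> dist t x < d \<Longrightarrow> t \<in> A"
      using A unfolding openin_euclidean_subtopology_iff by meson
    show ?case
    proof (intro exI[of _ d] conjI allI impI)
      fix a b N g
      assume ab: "a \<le> x \<and> x \<le> b \<and> b - a < d" "0 \<le> a" "b \<le> 1" and "start a N g"
      then have N: "openin Z N" "z \<in> N" and g: "continuous_map (subtopology Z N) X g"
        "\<And>w. w \<in> N \<Longrightarrow> p (g w) = F (a, w)"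
        by (auto simp: start_def)
      define M where "M = N \<inter> N0"
      have M: "openin Z M" "z \<in> M" "M \<subseteq> N" and MZ: "M \<subseteq> topspace Z"
        using N N0 openin_subset by (auto simp: M_def)
      have FW: "F (t, w) \<in> p ` W" if "t \<in> {a..b}" "w \<in> M" for t w
      proof -
        have "t \<in> A" using that ab by (intro d(2)) (auto simp: dist_real_def)
        then show ?thesis using AN that by (auto simp: M_def)
      qed
      have g': "continuous_map (subtopology Z M) X g"
        using g(1) M(3) continuous_map_from_subtopology_mono by blast
      have "continuous_map (S a b M) (subtopology Q (p ` W)) F"
        using FS[OF ab(2,3) M(1)] FW by (auto simp: continuous_map_in_subtopology S_def)
      then have u: "continuous_map (S a b M) X (\<lambda>y. \<sigma> (F y))"
        using continuous_map_compose[OF _ \<sigma>(1)] by (fastforce simp: o_def)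
      have ua: "continuous_map (subtopology Z M) X (\<lambda>w. \<sigma> (F (a, w)))"
        using continuous_map_compose[OF inner[of a a b M] u] ab by (auto simp: o_def)
      have pu: "p (\<sigma> (F (a, w))) = p (g w)" if "w \<in> M" for w
        using p\<sigma>[OF FW[of a w]] that g(2) M(3) ab by auto
      \<comment> \<open>Both \<open>\<sigma> (F (a, w))\<close> and \<open>g w\<close> lie over
        \<open>F (a, w)\<close>; this group element carries the first to the second and varies
        continuously with \<open>w\<close>.\<close>
      let ?h = "\<lambda>w. translation (\<sigma> (F (a, w)), g w)"
      have h: "continuous_map (subtopology Z M) (discrete_topology (carrier G)) ?h"
        using pu by (intro continuous_map_translation_compose ua g') auto
      have hG: "?h w \<in> carrier G" if "w \<in> M" for w
        using continuous_map_image_subset_topspace[OF h] that MZ by auto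
      have uX: "\<sigma> (F (t, w)) \<in> topspace X" if "t \<in> {a..b}" "w \<in> M" for t w
        using continuous_map_image_subset_topspace[OF u] that MZ
        by (auto simp: S_def image_subset_iff)
      \<comment> \<open>The lift through the local section, translated so as to start at \<open>g\<close>.\<close>
      let ?L = "\<lambda>y. act (\<sigma> (F y)) (?h (snd y))"
      have "continuous_map (S a b M) (subtopology Z M) snd"
        unfolding S_eq by (rule continuous_map_snd)
      from continuous_map_compose[OF this h]
      have "continuous_map (S a b M) (prod_topology X (discrete_topology (carrier G)))
          (\<lambda>y. (\<sigma> (F y), ?h (snd y)))"
        using u by (intro continuous_map_pairedI) (auto simp: o_def)
      from continuous_map_compose[OF this continuous_act]
      have "continuous_map (S a b M) X ?L"
        by (simp add: o_def)
      moreover have "?L (a, w) = g w" if "w \<in> M" for w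
        using that pu uX[of a w] ab g' MZ unfolding continuous_map_def
        by (auto intro!: translation(2))
      moreover have "p (?L (t, w)) = F (t, w)" if "t \<in> {a..b}" "w \<in> M" for t w
        using orbit_map_act[OF uX hG] p\<sigma>[OF FW] that by auto
      ultimately have "ext a b N g M ?L"
        unfolding ext_def using M by auto
      then show "\<exists>M L. ext a b N g M L" by blast
    qed (rule d(1))
  qed
  moreover have "start 0 (topspace Z) f"
    unfolding start_def using z f by auto
  ultimately obtain M L where "ext 0 1 (topspace Z) f M L" by blast
  then show thesis
    unfolding ext_def S_eq using that[of M L] by auto
qed

text \<open>Over each point \<open>w\<close> two local lifts restrict to lifts of the same path with
  the same start \<open>f w\<close>, so they agree by uniqueness on the connected interval. Hence
  the local lifts glue.\<close>

lemma lift_homotopy: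
  assumes F: "continuous_map (prod_topology (top_of_set {0..1::real}) Z) Q F"
    and f: "continuous_map Z X f" "\<And>z. z \<in> topspace Z \<Longrightarrow> p (f z) = F (0, z)"
  obtains L where "continuous_map (prod_topology (top_of_set {0..1}) Z) X L"
    "\<And>z. z \<in> topspace Z \<Longrightarrow> L (0, z) = f z"
    "\<And>t z. \<lbrakk>t \<in> {0..1}; z \<in> topspace Z\<rbrakk> \<Longrightarrow> p (L (t, z)) = F (t, z)"
proof -
  let ?I = "top_of_set {0..1::real}"
  have "\<exists>M L. openin Z M \<and> z \<in> M \<and>
    continuous_map (prod_topology ?I (subtopology Z M)) X L \<and> (\<forall>w\<in>M. L (0, w) = f w) \<and>
    (\<forall>t\<in>{0..1}. \<forall>w\<in>M. p (L (t, w)) = F (t, w))" if "z \<in> topspace Z" for z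
    by (rule lift_extension[OF F that f]) blast+
  then obtain M L where "\<forall>z\<in>topspace Z. openin Z (M z) \<and> z \<in> M z \<and>
    continuous_map (prod_topology ?I (subtopology Z (M z))) X (L z) \<and>
    (\<forall>w\<in>M z. L z (0, w) = f w) \<and> (\<forall>t\<in>{0..1}. \<forall>w\<in>M z. p (L z (t, w)) = F (t, w))"
    by metis
  then have lift: "openin Z (M z)" "z \<in> M z"
    "continuous_map (prod_topology ?I (subtopology Z (M z))) X (L z)"
    "\<And>w. w \<in> M z \<Longrightarrow> L z (0, w) = f w"
    "\<And>t w. \<lbrakk>t \<in> {0..1}; w \<in> M z\<rbrakk> \<Longrightarrow> p (L z (t, w)) = F (t, w)"
    if "z \<in> topspace Z" for z
    using that by blast+
  \<comment> \<open>At \<open>(t, w)\<close> the lift chosen for \<open>w\<close> itself is used; on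
    overlaps any other choice has the same value.\<close>
  let ?L = "\<lambda>y. L (snd y) y"
  have "continuous_map (prod_topology ?I Z) X ?L"
  proof (rule pasting_lemma[where I = "topspace Z" and T = "\<lambda>z. {0..1} \<times> M z" and f = L])
    show "openin (prod_topology ?I Z) ({0..1} \<times> M z)" if "z \<in> topspace Z" for z
      using that lift by (simp add: openin_prod_Times_iff)
    show "continuous_map (subtopology (prod_topology ?I Z) ({0..1} \<times> M z)) X (L z)"
      if "z \<in> topspace Z" for z
      using that lift by (simp add: subtopology_Times subtopology_subtopology)
    show "L i y = L j y" if ij: "i \<in> topspace Z" "j \<in> topspace Z"
      and y: "y \<in> topspace (prod_topology ?I Z) \<inter> {0..1} \<times> M i \<inter> {0..1} \<times> M j" for i j y
    proof -
      obtain t w where [simp]: "y = (t, w)" by fastforce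
      have tw: "t \<in> {0..1}" "w \<in> M i" "w \<in> M j" "w \<in> topspace Z" using y by auto
      have slice: "continuous_map ?I X (\<lambda>t. L k (t, w))" if "k \<in> topspace Z" "w \<in> M k" for k
      proof -
        have "continuous_map ?I (prod_topology ?I (subtopology Z (M k))) (\<lambda>t. (t, w))"
          using that tw by (intro continuous_map_pairedI) auto
        from continuous_map_compose[OF this lift(3)[OF that(1)]] show ?thesis
          by (simp add: o_def)
      qed
      have "L i (t, w) = L j (t, w)"
        using lift_unique[of ?I "\<lambda>t. L i (t, w)" "\<lambda>t. L j (t, w)" 0 t] slice ij tw lift(4,5)
        by (simp add: connected_space_subtopology connectedin_def)
      then show ?thesis by simp
    qed
    show "\<exists>j. j \<in> topspace Z \<and> y \<in> {0..1} \<times> M j \<and> ?L y = L j y"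
      if "y \<in> topspace (prod_topology ?I Z)" for y
      using that lift(2) by auto
  qed
  then show thesis
    using that[of ?L] lift by simp
qed

text \<open>Reversing time turns a prescribed end into a prescribed start. The end is what is known
  in the applications, because the homotopy of a local section ends at the inclusion.\<close>

lemma lift_homotopy_end:
  assumes F: "continuous_map (prod_topology (top_of_set {0..1::real}) Z) Q F"
    and f: "continuous_map Z X f" "\<And>z. z \<in> topspace Z \<Longrightarrow> p (f z) = F (1, z)"
  obtains L where "continuous_map (prod_topology (top_of_set {0..1}) Z) X L"
    "\<And>z. z \<in> topspace Z \<Longrightarrow> L (1, z) = f z"
    "\<And>t z. \<lbrakk>t \<in> {0..1}; z \<in> topspace Z\<rbrakk> \<Longrightarrow> p (L (t, z)) = F (t, z)"
proof -
  let ?I = "top_of_set {0..1::real}"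
  let ?r = "\<lambda>y. (1 - fst y, snd y)"
  have "continuous_map (prod_topology ?I Z) ?I (\<lambda>y. 1 - fst y)"
    by (auto simp: continuous_map_in_subtopology intro!: continuous_map_diff
        continuous_map_fst[THEN continuous_map_into_fulltopology])
  then have r: "continuous_map (prod_topology ?I Z) (prod_topology ?I Z) ?r"
    by (intro continuous_map_pairedI continuous_map_snd)
  have "continuous_map (prod_topology ?I Z) Q (F \<circ> ?r)"
    using continuous_map_compose[OF r F] .
  then obtain L where L: "continuous_map (prod_topology ?I Z) X L"
    "\<And>z. z \<in> topspace Z \<Longrightarrow> L (0, z) = f z"
    "\<And>t z. \<lbrakk>t \<in> {0..1}; z \<in> topspace Z\<rbrakk> \<Longrightarrow> p (L (t, z)) = (F \<circ> ?r) (t, z)"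
    using lift_homotopy[of Z "F \<circ> ?r" f] f by auto
  show thesis
    using that[of "L \<circ> ?r"] continuous_map_compose[OF r L(1)] L(2,3) by simp
qed

section \<open>The two inequalities\<close>

lemma TC_effv_le_TC_effl: "TC_effv (discrete_topology (carrier G)) X act \<le> TC_effl G X act"
  unfolding TC_effv_def TC_effl_def
proof (rule secat_pullback_le)
  let ?I = "top_of_set {0..1::real}"
  let ?h = "\<lambda>z. (fst z, p (snd z))"
  show h: "continuous_map (prod_topology X X) (prod_topology X Q) ?h"
    by (intro continuous_map_pairedI continuous_map_fst
        continuous_map_compose[OF continuous_map_snd continuous_map_orbit_map, unfolded o_def])
  fix U s
  assume "openin (prod_topology X Q) U"
    and "homotopy_local_section (path_space X) (prod_topology X Q) (\<lambda>\<gamma>. (\<gamma> 0, p (\<gamma> 1))) U s"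
  let ?V = "{z \<in> topspace (prod_topology X X). ?h z \<in> U}"
  define Z where "Z = subtopology (prod_topology X X) ?V"
  obtain H where sh: "continuous_map Z (path_space X) (\<lambda>z. s (?h z))"
    and H: "continuous_map (prod_topology ?I Z) (prod_topology X Q) H"
    and H0: "\<And>z. z \<in> topspace Z \<Longrightarrow> H (0, z) = (s (?h z) 0, p (s (?h z) 1))"
    and H1: "\<And>z. z \<in> topspace Z \<Longrightarrow> H (1, z) = ?h z"
    by (rule homotopy_local_section_pullback[OF h
          \<open>homotopy_local_section (path_space X) (prod_topology X Q) _ U s\<close> Z_def]) blast
  have "continuous_map (prod_topology ?I Z) Q (\<lambda>y. snd (H y))"
    using continuous_map_compose[OF H continuous_map_snd] by (simp add: o_def)
  moreover have "continuous_map Z X snd"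
    unfolding Z_def by (intro continuous_map_from_subtopology continuous_map_snd)
  ultimately obtain K where K: "continuous_map (prod_topology ?I Z) X K"
    "\<And>z. z \<in> topspace Z \<Longrightarrow> K (1, z) = snd z"
    "\<And>t z. \<lbrakk>t \<in> {0..1}; z \<in> topspace Z\<rbrakk> \<Longrightarrow> p (K (t, z)) = snd (H (t, z))"
    using lift_homotopy_end[of Z "\<lambda>y. snd (H y)" snd] H1 by auto
  have "continuous_map Z (prod_topology ?I Z) (\<lambda>z. (0, z))"
    by (intro continuous_map_pairedI) auto
  from continuous_map_compose[OF this K(1)]
  have K0: "continuous_map Z X (\<lambda>z. K (0, z))" by (simp add: o_def)
  have s1: "continuous_map Z X (\<lambda>z. s (?h z) 1)"
    using continuous_map_path_space_eval[OF sh] by simp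
  have psK: "p (s (?h z) 1) = p (K (0, z))" if "z \<in> topspace Z" for z
    using K(3)[of 0 z] H0 that by simp
  \<comment> \<open>The end of the path \<open>s (?h z)\<close> and the start of the lift
    \<open>K\<close> lie in one orbit by \<open>psK\<close>. The element \<open>?g z\<close> closes
    this gap, and the second path rests at \<open>K (0, z)\<close>.\<close>
  let ?g = "\<lambda>z. translation (s (?h z) 1, K (0, z))"
  let ?s = "\<lambda>z. (s (?h z), ?g z, \<lambda>t\<in>{0..1}. K (0, z))"
  have "continuous_map (prod_topology ?I Z) X (\<lambda>(t, z). K (0, z))"
    using continuous_map_compose[OF continuous_map_snd K0] by (simp add: o_def case_prod_unfold)
  then have "continuous_map Z (path_space X) (\<lambda>z. \<lambda>t\<in>{0..1}. K (0, z))"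
    using continuous_map_path_space_curry by fastforce
  moreover have "act (s (?h z) 1) (?g z) = K (0, z)" if "z \<in> topspace Z" for z
    using translation(2) psK that continuous_map_image_subset_topspace[OF K0]
      continuous_map_image_subset_topspace[OF s1] by blast
  ultimately have s': "continuous_map Z (broken_path_space (discrete_topology (carrier G)) X act) ?s"
    unfolding broken_path_space_def continuous_map_in_subtopology
    using sh continuous_map_translation_compose[OF s1 K0 psK]
    by (auto intro!: continuous_map_pairedI)
  \<comment> \<open>The first component of \<open>H\<close> already lives in \<open>X\<close> and is
    kept, while \<open>K\<close> replaces the second. At time 0 this gives the endpoints of the
    broken path, at time 1 the point \<open>z\<close>.\<close>
  have H': "continuous_map (prod_topology ?I Z) (prod_topology X X) (\<lambda>y. (fst (H y), K y))"
    using continuous_map_compose[OF H continuous_map_fst] K(1)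
    by (intro continuous_map_pairedI) (simp_all add: o_def)
  have "homotopy_local_section (broken_path_space (discrete_topology (carrier G)) X act)
      (prod_topology X X) (\<lambda>(\<alpha>\<^sub>1, g\<^sub>1, \<alpha>\<^sub>2). (\<alpha>\<^sub>1 0, \<alpha>\<^sub>2 1)) ?V ?s"
    using s' H' H0 H1 K(2) unfolding Z_def
    by (intro homotopy_local_sectionI) auto
  then show "\<exists>s'. homotopy_local_section (broken_path_space (discrete_topology (carrier G)) X act)
      (prod_topology X X) (\<lambda>(\<alpha>\<^sub>1, g\<^sub>1, \<alpha>\<^sub>2). (\<alpha>\<^sub>1 0, \<alpha>\<^sub>2 1))
      {z \<in> topspace (prod_topology X X). ?h z \<in> U} s'"
    by blast
qed

lemma TC_effl_le_TC: "TC_effl G X act \<le> TC Q"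
  unfolding TC_effl_def TC_def
proof (rule secat_pullback_le)
  let ?I = "top_of_set {0..1::real}"
  let ?h = "\<lambda>z. (p (fst z), snd z)"
  show h: "continuous_map (prod_topology X Q) (prod_topology Q Q) ?h"
    by (intro continuous_map_pairedI continuous_map_snd
        continuous_map_compose[OF continuous_map_fst continuous_map_orbit_map, unfolded o_def])
  fix U s
  assume "openin (prod_topology Q Q) U"
    and "homotopy_local_section (path_space Q) (prod_topology Q Q) (\<lambda>\<gamma>. (\<gamma> 0, \<gamma> 1)) U s"
  let ?V = "{z \<in> topspace (prod_topology X Q). ?h z \<in> U}"
  define Z where "Z = subtopology (prod_topology X Q) ?V"
  obtain H where sh: "continuous_map Z (path_space Q) (\<lambda>z. s (?h z))"
    and H: "continuous_map (prod_topology ?I Z) (prod_topology Q Q) H"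
    and H0: "\<And>z. z \<in> topspace Z \<Longrightarrow> H (0, z) = (s (?h z) 0, s (?h z) 1)"
    and H1: "\<And>z. z \<in> topspace Z \<Longrightarrow> H (1, z) = ?h z"
    by (rule homotopy_local_section_pullback[OF h
          \<open>homotopy_local_section (path_space Q) (prod_topology Q Q) _ U s\<close> Z_def]) blast
  have "continuous_map (prod_topology ?I Z) Q (\<lambda>y. fst (H y))"
    using continuous_map_compose[OF H continuous_map_fst] by (simp add: o_def)
  moreover have "continuous_map Z X fst"
    unfolding Z_def by (intro continuous_map_from_subtopology continuous_map_fst)
  ultimately obtain K where K: "continuous_map (prod_topology ?I Z) X K"
    "\<And>z. z \<in> topspace Z \<Longrightarrow> K (1, z) = fst z"
    "\<And>t z. \<lbrakk>t \<in> {0..1}; z \<in> topspace Z\<rbrakk> \<Longrightarrow> p (K (t, z)) = fst (H (t, z))"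
    using lift_homotopy_end[of Z "\<lambda>y. fst (H y)" fst] H1 by auto
  have "continuous_map Z (prod_topology ?I Z) (\<lambda>z. (0, z))"
    by (intro continuous_map_pairedI) auto
  from continuous_map_compose[OF this K(1)]
  have K0: "continuous_map Z X (\<lambda>z. K (0, z))" by (simp add: o_def)
  have pK: "p (K (0, z)) = s (?h z) 0" if "z \<in> topspace Z" for z
    using K(3)[of 0 z] H0 that by simp
  \<comment> \<open>The path \<open>s (?h z)\<close> in the orbit space is lifted with all
    parameters \<open>z\<close> at once, starting at \<open>K (0, z)\<close>, which lies over its
    initial point by \<open>pK\<close>.\<close>
  obtain L where L: "continuous_map (prod_topology ?I Z) X L"
    "\<And>z. z \<in> topspace Z \<Longrightarrow> L (0, z) = K (0, z)"
    "\<And>t z. \<lbrakk>t \<in> {0..1}; z \<in> topspace Z\<rbrakk> \<Longrightarrow> p (L (t, z)) = s (?h z) t"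
    using lift_homotopy[OF continuous_map_path_space_uncurry[OF sh] K0] pK by auto
  let ?s = "\<lambda>z. \<lambda>t\<in>{0..1}. L (t, z)"
  have s': "continuous_map Z (path_space X) ?s"
    using continuous_map_path_space_curry[OF L(1)] .
  \<comment> \<open>Only the first component needs a lift, the second factor being the orbit space
    itself. The start matches because \<open>L (1, z)\<close> lies over the end of
    \<open>s (?h z)\<close>.\<close>
  have H': "continuous_map (prod_topology ?I Z) (prod_topology X Q) (\<lambda>y. (K y, snd (H y)))"
    using continuous_map_compose[OF H continuous_map_snd] K(1)
    by (intro continuous_map_pairedI) (simp_all add: o_def)
  have "homotopy_local_section (path_space X) (prod_topology X Q) (\<lambda>\<gamma>. (\<gamma> 0, p (\<gamma> 1))) ?V ?s"
    using s' H' H0 H1 K(2) L(2,3) unfolding Z_def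
    by (intro homotopy_local_sectionI) auto
  then show "\<exists>s'. homotopy_local_section (path_space X) (prod_topology X Q)
      (\<lambda>\<gamma>. (\<gamma> 0, p (\<gamma> 1))) {z \<in> topspace (prod_topology X Q). ?h z \<in> U} s'"
    by blast
qed

end

theorem theorem1p1:
  fixes G :: "('g, 'b) monoid_scheme" and X :: "'x topology" and act :: "'x \<Rightarrow> 'g \<Rightarrow> 'x"
  assumes "Hausdorff_space X"
    and "right_G_space G (discrete_topology (carrier G)) X act"
    and "properly_discontinuous G X act"
  shows "TC_effv (discrete_topology (carrier G)) X act \<le> TC_effl G X act \<and>
         TC_effl G X act \<le> TC (orbit_space G X act)"
proof -
  interpret properly_discontinuous_space G X act
    using assms(2,3)
    by (intro properly_discontinuous_space.intro properly_discontinuous_space_axioms.intro)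
  show ?thesis
    using TC_effv_le_TC_effl TC_effl_le_TC by blast
qed

end
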